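(* Let $u$ and $v$ be $\mathbf{a}\mathbf{b}$-monomials (words in the non-commuting letters $\mathbf{a},\mathbf{b}$, possibly the empty word $1$) of degree $p$ and $q$, respectively. Then the $\mathbf{a}\mathbf{b}$-polynomial $u\diamond v$ is given by $$u\diamond v=\sum_{P\in \Omega(p,q)} \operatorname{wt}_{u,v}(P),$$ where $\diamond$ is the diamond product on $\mathbb{Z}\langle\mathbf{a},\mathbf{b}\rangle$, $\Omega(p,q)$ is the set of lattice paths from $(0,0)$ to $(p,q)$ with steps $\mathbf{R}=(1,0)$, $\mathbf{U}=(0,1)$, $\mathbf{D}=(1,1)$ having no $\mathbf{U}$ step immediately followed by an $\mathbf{R}$ step, and $\operatorname{wt}_{u,v}$ is the weight function determined by labeling the horizontal axis by $u$ and the vertical axis by $v$.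
   Context: **Ring and coproduct.** $\mathbb{Z}\langle\mathbf{a},\mathbf{b}\rangle$ is the ring of polynomials in non-commuting variables $\mathbf{a},\mathbf{b}$, each of degree $1$. The coproduct $\Delta:\mathbb{Z}\langle\mathbf{a},\mathbf{b}\rangle\to\mathbb{Z}\langle\mathbf{a},\mathbf{b}\rangle\otimes\mathbb{Z}\langle\mathbf{a},\mathbf{b}\rangle$ is the linear map given on a monomial $u=u_1\cdots u_n$ (each $u_i\in\{\mathbf{a},\mathbf{b}\}$) by $$\Delta(u)=\sum_{i=1}^n u_1\cdots u_{i-1}\otimes u_{i+1}\cdots u_n,\qquad \Delta(1)=0.$$ Sweedler notation: $\Delta(u)=\sum_u u_{(1)}\otimes u_{(2)}$. **Diamond product.** $\diamond:\mathbb{Z}\langle\mathbf{a},\mathbf{b}\rangle\times\mathbb{Z}\langle\mathbf{a},\mathbf{b}\rangle\to\mathbb{Z}\langle\mathbf{a},\mathbf{b}\rangle$ is the bilinear operator (determined uniquely) satisfying, for all $\mathbf{a}\mathbf{b}$-polynomials $u,v$, $$u\diamond 1=u,$$ $$u\diamond (v\cdot \mathbf{a}) =(u\diamond v)\cdot \mathbf{a} + \sum_u (u_{(1)} \diamond v)\cdot \mathbf{a}\cdot\mathbf{b} \cdot u_{(2)},$$ $$u\diamond (v\cdot \mathbf{b}) = (u\diamond v)\cdot \mathbf{b} + \sum_u (u_{(1)} \diamond v)\cdot \mathbf{b}\cdot\mathbf{a} \cdot u_{(2)}.$$ **Lattice paths.** Lattice paths are words in the letters $\mathbf{R}=(1,0)$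 (right), $\mathbf{U}=(0,1)$ (up), $\mathbf{D}=(1,1)$ (diagonal), read from left to right as successive steps starting at $(0,0)$. $\Omega(p,q)$ is the set of such paths from $(0,0)$ to $(p,q)$ that do not contain $\mathbf{U}\mathbf{R}$ as a contiguous subword. **Labels and weight.** For $u=u_1\cdots u_p$ and $v=v_1\cdots v_q$, label the unit interval $[i-1,i]$ of the horizontal axis by $u_i$ and the unit interval $[j-1,j]$ of the vertical axis by $v_j$. A step is "above" the label $u_i$ if it goes from $x$-coordinate $i-1$ to $i$, and "to the right of" the label $v_j$ if it goes from $y$-coordinate $j-1$ to $j$. The weight $\operatorname{wt}_{u,v}(P)\in\mathbb{Z}\langle\mathbf{a},\mathbf{b}\rangle$ of a path $P$ is the product, in order along the path, of the weights of its steps, where: - an $\mathbf{R}$ step has weight $\mathbf{a}$ if it is above an $\mathbf{a}$ label, and $\mathbf{b}$ if it is above a $\mathbf{b}$ label; - a $\mathbf{U}$ step has weight $\mathbf{a}$ if it is to the right of an $\mathbf{a}$ label, and $\mathbf{b}$ if it is to the right of a $\mathbf{b}$ label; - a $\mathbf{D}$ step has weight $\mathbf{a}\cdot\mathbf{b}$ if it is to the right of an $\mathbf{a}$ label, and $\mathbf{b}\cdot\mathbf{a}$ if it is to the right of a $\mathbf{b}$ label. *)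

theory Defs
  imports
    Complex_Main
    "HOL-Library.Poly_Mapping"
    "HOL-Library.Product_Plus"
    "HOL-Library.Sublist"
begin

text \<open>
  The type \<open>'a list\<close> becomes the free monoid on \<open>'a\<close>, written additively because
  \<^theory>\<open>HOL-Library.Poly_Mapping\<close> builds monoid rings from an additive monoid of exponents.
  Thus \<open>letter list \<Rightarrow>\<^sub>0 int\<close> is the ring of integer polynomials in two noncommuting
  variables, and \<open>frag_of w\<close> is the monomial \<open>w\<close>.
\<close>

instantiation list :: (type) monoid_add
begin

definition zero_list :: "'a list" where "zero_list = []"

definition plus_list :: "'a list \<Rightarrow> 'a list \<Rightarrow> 'a list" where "plus_list = (@)"

instance
  by standard (simp_all add: zero_list_def plus_list_def)

end

datatype letter = A | B

type_synonym ab_poly = "letter list \<Rightarrow>\<^sub>0 int"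

definition var :: "letter \<Rightarrow> ab_poly" where
  "var x = frag_of [x]"

text \<open>
  The tensor square is free abelian on the pairs of words; \<open>frag_of (s, t)\<close> is the pure
  tensor of the monomials \<open>s\<close> and \<open>t\<close>. The summation index \<open>i\<close> counts from \<open>0\<close>.
\<close>

type_synonym ab_tensor = "(letter list \<times> letter list) \<Rightarrow>\<^sub>0 int"

definition coproduct :: "ab_poly \<Rightarrow> ab_tensor" where
  "coproduct = frag_extend (\<lambda>w. \<Sum>i<length w. frag_of (take i w, drop (Suc i) w))"

text \<open>
  For a biadditive \<open>\<beta>\<close> this is the Sweedler sum of the values of \<open>\<beta>\<close> on the tensor factors
  of the coproduct of \<open>u\<close>, i.e. the linear map on the tensor square induced by \<open>\<beta>\<close>,
  applied to \<open>coproduct u\<close>.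
\<close>

definition sweedler_sum :: "(ab_poly \<Rightarrow> ab_poly \<Rightarrow> ab_poly) \<Rightarrow> ab_poly \<Rightarrow> ab_poly" where
  "sweedler_sum \<beta> u = frag_extend (\<lambda>(s, t). \<beta> (frag_of s) (frag_of t)) (coproduct u)"

text \<open>Bilinearity over the integers is additivity in each argument.\<close>

definition is_diamond :: "(ab_poly \<Rightarrow> ab_poly \<Rightarrow> ab_poly) \<Rightarrow> bool" where
  "is_diamond f \<longleftrightarrow>
     (\<forall>u. additive (f u)) \<and>
     (\<forall>v. additive (\<lambda>u. f u v)) \<and>
     (\<forall>u. f u 1 = u) \<and>
     (\<forall>u v. f u (v * var A) =
        f u v * var A + sweedler_sum (\<lambda>u1 u2. f u1 v * var A * var B * u2) u) \<and>
     (\<forall>u v. f u (v * var B) =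
        f u v * var B + sweedler_sum (\<lambda>u1 u2. f u1 v * var B * var A * u2) u)"

definition diamond :: "ab_poly \<Rightarrow> ab_poly \<Rightarrow> ab_poly"  (infixl \<open>\<diamondop>\<close> 70) where
  "diamond = (THE f. is_diamond f)"

subsection \<open>Existence and uniqueness of the diamond product\<close>

lemma frag_of_mult: "frag_of v * frag_of w = frag_of (v @ w)"
  by (simp add: mult_single plus_list_def)

lemma one_eq_frag_of: "(1 :: ab_poly) = frag_of []"
  by (simp add: zero_list_def flip: single_one)

lemma frag_of_snoc: "frag_of (w @ [x]) = frag_of w * var x"
  by (simp add: var_def frag_of_mult)

lemma sweedler_sum_add: "sweedler_sum \<beta> (u + v) = sweedler_sum \<beta> u + sweedler_sum \<beta> v"
  by (simp add: sweedler_sum_def coproduct_def frag_extend_add)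

lemma frag_extend_add_fun:
  "frag_extend (\<lambda>x. f x + g x) u = frag_extend f u + frag_extend g u"
  by (simp add: frag_extend_def frag_cmul_distrib2 sum.distrib)

lemma sweedler_sum_add_fun:
  "sweedler_sum (\<lambda>s t. \<beta> s t + \<gamma> s t) u = sweedler_sum \<beta> u + sweedler_sum \<gamma> u"
  by (simp add: sweedler_sum_def case_prod_unfold frag_extend_add_fun)

lemma sweedler_sum_cong:
  assumes "\<And>s t. \<beta> (frag_of s) (frag_of t) = \<gamma> (frag_of s) (frag_of t)"
  shows "sweedler_sum \<beta> u = sweedler_sum \<gamma> u"
  by (simp add: sweedler_sum_def assms)

lemma additive_eqI:
  fixes f g :: "ab_poly \<Rightarrow> ab_poly"
  assumes "additive f" "additive g" and eq: "\<And>w. f (frag_of w) = g (frag_of w)"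
  shows "f u = g u"
proof -
  have "Poly_Mapping.keys u \<subseteq> UNIV" by simp
  then show ?thesis
    by (rule frag_induction)
       (simp_all add: eq additive.zero[OF assms(1)] additive.zero[OF assms(2)]
          additive.diff[OF assms(1)] additive.diff[OF assms(2)])
qed

lemma is_diamond_unique:
  assumes f: "is_diamond f" and g: "is_diamond g"
  shows "f = g"
proof (intro ext)
  fix u v
  have eq: "f u (frag_of w) = g u (frag_of w)" for u w
  proof (induction w arbitrary: u rule: rev_induct)
    case Nil
    then show ?case
      using f g by (simp add: is_diamond_def flip: one_eq_frag_of)
  next
    case (snoc x w)
    show ?case
      by (cases x) (use f g in \<open>simp_all add: is_diamond_def frag_of_snoc snoc\<close>)
  qed
  have "additive (f u)" "additive (g u)"
    using f g unfolding is_diamond_def by blast+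
  then show "f u v = g u v"
    using eq by (rule additive_eqI)
qed

primrec swap :: "letter \<Rightarrow> letter" where
  "swap A = B"
| "swap B = A"

primrec diamond_rev :: "letter list \<Rightarrow> ab_poly \<Rightarrow> ab_poly" where
  "diamond_rev [] u = u"
| "diamond_rev (x # w) u =
     diamond_rev w u * var x
     + sweedler_sum (\<lambda>u1 u2. diamond_rev w u1 * var x * var (swap x) * u2) u"

lemma diamond_rev_add: "diamond_rev w (u + v) = diamond_rev w u + diamond_rev w v"
  by (induction w arbitrary: u v) (simp_all add: sweedler_sum_add algebra_simps)

lemma is_diamond_exists: "\<exists>f. is_diamond f"
proof -
  define f where "f u v = frag_extend (\<lambda>w. diamond_rev (rev w) u) v" for u and v :: ab_poly
  have add2: "additive (f u)" for u
    by (simp add: additive_def f_def frag_extend_add)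
  have add1: "additive (\<lambda>u. f u v)" for v
    by (simp add: additive_def f_def diamond_rev_add frag_extend_add_fun)
  have f_word: "f u (frag_of w) = diamond_rev (rev w) u" for u w
    by (simp add: f_def)
  have step: "f u (v * var x) =
      f u v * var x + sweedler_sum (\<lambda>u1 u2. f u1 v * var x * var (swap x) * u2) u" for u v x
  proof (rule additive_eqI[where f = "\<lambda>v. f u (v * var x)"])
    show "additive (\<lambda>v. f u (v * var x))"
      by (simp add: additive_def distrib_right additive.add[OF add2])
    show "additive (\<lambda>v. f u v * var x +
        sweedler_sum (\<lambda>u1 u2. f u1 v * var x * var (swap x) * u2) u)"
      by (auto simp: additive_def distrib_right additive.add[OF add2]
          sweedler_sum_add_fun[symmetric] intro!: sweedler_sum_cong)
    show "f u (frag_of w * var x) = f u (frag_of w) * var x +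
        sweedler_sum (\<lambda>u1 u2. f u1 (frag_of w) * var x * var (swap x) * u2) u" for w
      by (simp add: f_word flip: frag_of_snoc)
  qed
  have "f u 1 = u" for u
    by (simp add: one_eq_frag_of f_word)
  then have "is_diamond f"
    using add1 add2 step[of _ _ A] step[of _ _ B] by (simp add: is_diamond_def)
  then show ?thesis by blast
qed

lemma is_diamond_diamond: "is_diamond (\<diamondop>)"
proof -
  have "\<exists>!f. is_diamond f"
    using is_diamond_exists is_diamond_unique by blast
  from theI'[OF this] show ?thesis
    by (simp add: diamond_def)
qed

subsection \<open>Lattice paths and weights\<close>

datatype step = R | U | D

primrec displacement :: "step \<Rightarrow> nat \<times> nat" where
  "displacement R = (1, 0)"
| "displacement U = (0, 1)"
| "displacement D = (1, 1)"

definition endpoint :: "step list \<Rightarrow> nat \<times> nat" where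
  "endpoint P = sum_list (map displacement P)"

text \<open>\<^const>\<open>sublist\<close> is the contiguous-subword relation.\<close>

definition \<Omega> :: "nat \<Rightarrow> nat \<Rightarrow> step list set" where
  "\<Omega> p q = {P. endpoint P = (p, q) \<and> \<not> sublist [U, R] P}"

text \<open>
  The weight of a step that starts at the given lattice point. Words are indexed from \<open>0\<close>, so
  the unit interval starting at \<open>x\<close> carries the label \<open>u ! x\<close>.
\<close>

fun step_weight :: "letter list \<Rightarrow> letter list \<Rightarrow> nat \<times> nat \<Rightarrow> step \<Rightarrow> ab_poly" where
  "step_weight u v (x, y) R = (case u ! x of A \<Rightarrow> var A | B \<Rightarrow> var B)"
| "step_weight u v (x, y) U = (case v ! y of A \<Rightarrow> var A | B \<Rightarrow> var B)"
| "step_weight u v (x, y) D = (case v ! y of A \<Rightarrow> var A * var B | B \<Rightarrow> var B * var A)"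

definition wt :: "letter list \<Rightarrow> letter list \<Rightarrow> step list \<Rightarrow> ab_poly" where
  "wt u v P = prod_list (map (\<lambda>i. step_weight u v (endpoint (take i P)) (P ! i)) [0..<length P])"

text \<open>Sums over \<^const>\<open>\<Omega>\<close> are genuine sums, not the default value for infinite index sets.\<close>

lemma finite_\<Omega>: "finite (\<Omega> p q)"
proof -
  have "length P \<le> fst (endpoint P) + snd (endpoint P)" for P
  proof (induction P)
    case (Cons s P)
    then show ?case by (cases s) (simp_all add: endpoint_def)
  qed (simp add: endpoint_def)
  then have "length P \<le> p + q" if "P \<in> \<Omega> p q" for P
    using that by (metis (mono_tags, lifting) \<Omega>_def fst_conv mem_Collect_eq snd_conv)
  then have "\<Omega> p q \<subseteq> {P. set P \<subseteq> {R, U, D} \<and> length P \<le> p + q}"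
    by (auto intro: step.exhaust)
  then show ?thesis
    by (rule finite_subset) (intro finite_lists_length_le, simp)
qed

end

theory Submission
  imports Defs
begin

text \<open>
  The proof is an induction on \<open>v\<close>, appending one letter \<open>x\<close> at a time. In a path to height
  \<open>q + 1\<close>, look at the last step that is not \<open>R\<close>. If it is \<open>U\<close>, then it ends the path, as \<open>UR\<close>
  is forbidden; these paths contribute \<open>(u \<diamondop> v) \<cdot> x\<close>. If it is \<open>D\<close>, above the letter \<open>u\<^sub>i\<close>,
  then the rest of the path reads off the letters of \<open>u\<close> after \<open>u\<^sub>i\<close>; these paths contribute the
  \<open>i\<close>-th term of the Sweedler sum over the coproduct of \<open>u\<close>.
\<close>

lemma diamond_one: "u \<diamondop> 1 = u"
  using is_diamond_diamond by (simp add: is_diamond_def)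

lemma diamond_mult_var:
  "u \<diamondop> (v * var x) =
    (u \<diamondop> v) * var x + sweedler_sum (\<lambda>u1 u2. (u1 \<diamondop> v) * var x * var (swap x) * u2) u"
  using is_diamond_diamond by (cases x) (simp_all add: is_diamond_def)

lemma frag_extend_sum:
  "frag_extend f (\<Sum>i\<in>I. g i) = (\<Sum>i\<in>I. frag_extend f (g i))"
  by (induction I rule: infinite_finite_induct) (simp_all add: frag_extend_add)

text \<open>The index \<open>i\<close> is the position of the letter removed by the coproduct. It
  will match the column in which the last \<open>D\<close> step starts.\<close>

lemma sweedler_sum_frag_of:
  "sweedler_sum \<beta> (frag_of w) =
    (\<Sum>i<length w. \<beta> (frag_of (take i w)) (frag_of (drop (Suc i) w)))"
  by (simp add: sweedler_sum_def coproduct_def frag_extend_sum)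

lemma endpoint_Nil [simp]: "endpoint [] = 0"
  by (simp add: endpoint_def)

lemma endpoint_append [simp]: "endpoint (P @ Q) = endpoint P + endpoint Q"
  by (simp add: endpoint_def)

lemma endpoint_Cons [simp]: "endpoint (s # P) = displacement s + endpoint P"
  by (simp add: endpoint_def)

lemma endpoint_replicate_R [simp]: "endpoint (replicate n R) = (n, 0)"
  by (induction n) (simp_all add: zero_prod_def)

lemma wt_Nil [simp]: "wt u v [] = 1"
  by (simp add: wt_def)

lemma wt_snoc: "wt u v (P @ [s]) = wt u v P * step_weight u v (endpoint P) s"
proof -
  have "map (\<lambda>i. step_weight u v (endpoint (take i (P @ [s]))) ((P @ [s]) ! i)) [0..<Suc (length P)] =
        map (\<lambda>i. step_weight u v (endpoint (take i P)) (P ! i)) [0..<length P] @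
          [step_weight u v (endpoint P) s]"
    by (simp add: nth_append)
  then show ?thesis
    by (simp add: wt_def del: upt_Suc)
qed

lemma step_weight_R: "step_weight u v (x, y) R = var (u ! x)"
  by (cases "u ! x") simp_all

lemma step_weight_U: "step_weight u v (x, y) U = var (v ! y)"
  by (cases "v ! y") simp_all

lemma step_weight_D: "step_weight u v (x, y) D = var (v ! y) * var (swap (v ! y))"
  by (cases "v ! y") simp_all

text \<open>A run of \<open>R\<close> steps from column \<open>x\<close> reads off consecutive
  letters of \<open>u\<close>; the bound on \<open>x + n\<close> keeps every index in range.\<close>

lemma wt_append_replicate_R:
  assumes "endpoint P = (x, y)" and "x + n \<le> length u"
  shows "wt u v (P @ replicate n R) = wt u v P * frag_of (take n (drop x u))"
  using assms(2)
proof (induction n)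
  case 0
  then show ?case by (simp add: zero_list_def flip: one_eq_frag_of)
next
  case (Suc n)
  have "P @ replicate (Suc n) R = (P @ replicate n R) @ [R]"
    by (simp add: replicate_append_same)
  with Suc show ?case
    by (simp only: wt_snoc)
       (simp add: assms(1) step_weight_R take_Suc_conv_app_nth frag_of_snoc mult.assoc
          del: step_weight.simps)
qed

text \<open>Only labels up to the endpoint of a path are ever read. The induction can thus discard
  the new letter of \<open>v\<close>, and the letters of \<open>u\<close> beyond the column where an
  initial segment stops.\<close>

lemma wt_append_words:
  assumes "fst (endpoint P) \<le> length u" and "snd (endpoint P) \<le> length v"
  shows "wt (u @ u') (v @ v') P = wt u v P"
  using assms
proof (induction P rule: rev_induct)
  case (snoc s P)
  obtain x y where xy: "endpoint P = (x, y)" by (cases "endpoint P")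
  show ?case
    using snoc xy
    by (cases s) (simp_all add: wt_snoc step_weight_R step_weight_U step_weight_D nth_append
        del: step_weight.simps)
qed simp

lemma sublist_UR_snoc:
  "sublist [U, R] (P @ [s]) \<longleftrightarrow> sublist [U, R] P \<or> s = R \<and> P \<noteq> [] \<and> last P = U"
proof -
  \<comment> \<open>An occurrence created by appending \<open>s\<close> must end in
    \<open>s\<close>.\<close>
  have "suffix [U, R] (P @ [s]) \<longleftrightarrow> s = R \<and> P \<noteq> [] \<and> last P = U"
    by (cases P rule: rev_cases) (auto simp: suffix_def)
  then show ?thesis
    by (auto simp: sublist_snoc)
qed

text \<open>No occurrence of \<open>UR\<close> can contain the \<open>D\<close>, and the run after
  it has no \<open>U\<close>.\<close>

lemma sublist_UR_append_D_replicate: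
  "sublist [U, R] (P @ D # replicate n R) \<longleftrightarrow> sublist [U, R] P"
proof (induction n)
  case (Suc n)
  have "P @ D # replicate (Suc n) R = (P @ D # replicate n R) @ [R]"
    by (simp add: replicate_append_same)
  with Suc show ?case
    by (simp only: sublist_UR_snoc) auto
qed (simp add: sublist_UR_snoc)

lemma sublist_UR_append_U_replicate:
  "sublist [U, R] (P @ U # replicate n R) \<longleftrightarrow> sublist [U, R] P \<or> n > 0"
proof (cases n)
  case (Suc m)
  then have "P @ U # replicate n R = P @ [U, R] @ replicate m R" by simp
  then show ?thesis using Suc by (metis sublist_appendI zero_less_Suc)
qed (simp add: sublist_UR_snoc)

text \<open>Splits a path at its last step other than \<open>R\<close>, if there is one.\<close>

lemma path_cases:
  obtains (replicate) n where "P = replicate n R"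
  | (U) Q n where "P = Q @ U # replicate n R"
  | (D) Q n where "P = Q @ D # replicate n R"
proof -
  have "(\<exists>n. P = replicate n R) \<or> (\<exists>Q n. P = Q @ U # replicate n R) \<or>
        (\<exists>Q n. P = Q @ D # replicate n R)"
  proof (induction P rule: rev_induct)
    case Nil
    have "[] = replicate 0 R" by simp
    then show ?case by blast
  next
    case (snoc s P)
    show ?case
    proof (cases s)
      case R
      \<comment> \<open>Absorbs the new step into the run. \<open>replicate_Suc\<close> is removed
        from the simpset below so that it does not unfold the run again from the front.\<close>
      have [simp]: "replicate n R @ [R] = replicate (Suc n) R" for n
        by (simp add: replicate_append_same)
      from snoc show ?thesis
      proof (elim disjE exE)
        fix n assume "P = replicate n R"
        with R have "P @ [s] = replicate (Suc n) R" by (simp del: replicate_Suc)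
        then show ?thesis by blast
      next
        fix Q n assume "P = Q @ U # replicate n R"
        with R have "P @ [s] = Q @ U # replicate (Suc n) R" by (simp del: replicate_Suc)
        then show ?thesis by blast
      next
        fix Q n assume "P = Q @ D # replicate n R"
        with R have "P @ [s] = Q @ D # replicate (Suc n) R" by (simp del: replicate_Suc)
        then show ?thesis by blast
      qed
    next
      case U
      then have "P @ [s] = P @ U # replicate 0 R" by simp
      then show ?thesis by blast
    next
      case D
      then have "P @ [s] = P @ D # replicate 0 R" by simp
      then show ?thesis by blast
    qed
  qed
  then show ?thesis using that by blast
qed

lemma \<Omega>_0: "\<Omega> p 0 = {replicate p R}"
proof -
  have "\<not> sublist [U, R] (replicate p R)"
    by (metis in_set_replicate list.set_intros(1) set_mono_sublist step.distinct(1) subsetD)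
  moreover have "P = replicate p R" if "endpoint P = (p, 0)" for P
  \<comment> \<open>A \<open>U\<close> or \<open>D\<close> step would raise the path above height
    0.\<close>
  proof (cases P rule: path_cases)
    case (U Q n)
    with that show ?thesis by (cases "endpoint Q") simp
  next
    case (D Q n)
    with that show ?thesis by (cases "endpoint Q") simp
  qed (use that in simp)
  ultimately show ?thesis
    by (auto simp: \<Omega>_def)
qed

text \<open>Here \<open>i\<close> is the column where the last \<open>D\<close> starts. It ends in
  column \<open>Suc i\<close>, which leaves \<open>p - Suc i\<close> steps \<open>R\<close>; the
  subtraction is exact as \<open>i < p\<close>.\<close>

lemma \<Omega>_Suc:
  "\<Omega> p (Suc q) = (\<lambda>P. P @ [U]) ` \<Omega> p q \<union>
    (\<Union>i<p. (\<lambda>P. P @ D # replicate (p - Suc i) R) ` \<Omega> i q)" (is "_ = ?U \<union> ?D")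
proof
  show "\<Omega> p (Suc q) \<subseteq> ?U \<union> ?D"
  proof
    fix P assume P: "P \<in> \<Omega> p (Suc q)"
    show "P \<in> ?U \<union> ?D"
    proof (cases P rule: path_cases)
      case (replicate n)
      with P show ?thesis by (simp add: \<Omega>_def)
    next
      case (U Q n)
      with P have "n = 0" "Q \<in> \<Omega> p q"
        by (cases "endpoint Q"; simp add: \<Omega>_def sublist_UR_append_U_replicate)+
      with U show ?thesis by auto
    next
      case (D Q n)
      obtain i j where ij: "endpoint Q = (i, j)" by (cases "endpoint Q")
      with P D have "Q \<in> \<Omega> i q" "p = i + Suc n"
        by (simp_all add: \<Omega>_def sublist_UR_append_D_replicate)
      then have "P = Q @ D # replicate (p - Suc i) R" "i < p"
        using D by simp_all
      with \<open>Q \<in> \<Omega> i q\<close> show ?thesis by blast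
    qed
  qed
  show "?U \<union> ?D \<subseteq> \<Omega> p (Suc q)"
    by (auto simp: \<Omega>_def sublist_UR_snoc sublist_UR_append_D_replicate)
qed

lemma append_D_replicate_R_eq:
  assumes "P @ D # replicate m R = Q @ D # replicate n R"
  shows "m = n"
proof -
  \<comment> \<open>Reversal turns the final run into an initial one, which stops at the
    \<open>D\<close>.\<close>
  have "length (takeWhile ((=) R) (rev (P @ D # replicate k R))) = k" for P k
    by (simp add: takeWhile_append)
  with assms show ?thesis by metis
qed

text \<open>The pieces of the decomposition are disjoint, since the path determines its last step
  other than \<open>R\<close> and the length of the run after it. The maps onto the pieces are
  injective.\<close>

lemma sum_\<Omega>_Suc:
  "(\<Sum>P\<in>\<Omega> p (Suc q). f P) = (\<Sum>P\<in>\<Omega> p q. f (P @ [U])) +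
    (\<Sum>i<p. \<Sum>P\<in>\<Omega> i q. f (P @ D # replicate (p - Suc i) R))"
proof -
  let ?F = "\<lambda>i P. P @ D # replicate (p - Suc i) R"
  have "P @ [U] \<noteq> Q @ D # replicate n R" for P Q n
    by (cases n) (auto simp flip: replicate_append_same)
  then have disj: "(\<lambda>P. P @ [U]) ` \<Omega> p q \<inter> (\<Union>i<p. ?F i ` \<Omega> i q) = {}"
    by blast
  have disjD: "?F i ` \<Omega> i q \<inter> ?F j ` \<Omega> j q = {}" if "i < p" "j < p" "i \<noteq> j" for i j
  proof (rule ccontr)
    assume "?F i ` \<Omega> i q \<inter> ?F j ` \<Omega> j q \<noteq> {}"
    then obtain P Q where "?F i P = ?F j Q" by blast
    then have "p - Suc i = p - Suc j" by (rule append_D_replicate_R_eq)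
    with that show False by linarith
  qed
  have "(\<Sum>P\<in>\<Omega> p (Suc q). f P) =
      sum f ((\<lambda>P. P @ [U]) ` \<Omega> p q) + sum f (\<Union>i<p. ?F i ` \<Omega> i q)"
    unfolding \<Omega>_Suc by (rule sum.union_disjoint[OF _ _ disj]) (simp_all add: finite_\<Omega>)
  also have "sum f (\<Union>i<p. ?F i ` \<Omega> i q) = (\<Sum>i<p. sum f (?F i ` \<Omega> i q))"
    by (rule sum.UNION_disjoint) (simp_all add: finite_\<Omega> disjD)
  finally show ?thesis
    by (simp add: sum.reindex inj_on_def)
qed

lemma wt_snoc_U:
  assumes "P \<in> \<Omega> (length u) (length v)"
  shows "wt u (v @ [x]) (P @ [U]) = wt u v P * var x"
  using assms wt_append_words[of P u v "[]" "[x]"]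
  by (simp add: \<Omega>_def wt_snoc step_weight_U del: step_weight.simps)

text \<open>The \<open>D\<close> step starts at height \<open>length v\<close>, so its label is
  \<open>x\<close>. It passes over \<open>u ! i\<close> without reading it, which is the letter
  deleted by the coproduct.\<close>

lemma wt_append_D_replicate_R:
  assumes P: "P \<in> \<Omega> i (length v)" and i: "i < length u"
  shows "wt u (v @ [x]) (P @ D # replicate (length u - Suc i) R) =
    wt (take i u) v P * var x * var (swap x) * frag_of (drop (Suc i) u)"
proof -
  have e: "endpoint P = (i, length v)"
    using P by (simp add: \<Omega>_def)
  have "wt u (v @ [x]) ((P @ [D]) @ replicate (length u - Suc i) R) =
      wt u (v @ [x]) (P @ [D]) * frag_of (drop (Suc i) u)"
    using i by (subst wt_append_replicate_R[where x = "Suc i" and y = "Suc (length v)"])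
      (simp_all add: e)
  moreover have "wt u (v @ [x]) P = wt (take i u) v P"
    using wt_append_words[of P "take i u" v "drop i u" "[x]"] i by (simp add: e)
  ultimately show ?thesis
    by (simp add: wt_snoc e step_weight_D mult.assoc del: step_weight.simps)
qed

lemma diamond_eq_sum_wt:
  "frag_of u \<diamondop> frag_of v = (\<Sum>P\<in>\<Omega> (length u) (length v). wt u v P)"
\<comment> \<open>\<open>u\<close> is generalized because the Sweedler sum calls the hypothesis for
  the prefixes \<open>take i u\<close>.\<close>
proof (induction v arbitrary: u rule: rev_induct)
  case Nil
  have "wt u [] (replicate (length u) R) = frag_of u"
    using wt_append_replicate_R[of "[]" 0 0 "length u" u "[]"] by (simp add: zero_prod_def)
  then show ?case
    by (simp add: \<Omega>_0 diamond_one flip: one_eq_frag_of)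
next
  case (snoc x v)
  have "frag_of u \<diamondop> frag_of (v @ [x]) =
      (\<Sum>P\<in>\<Omega> (length u) (length v). wt u v P) * var x +
      (\<Sum>i<length u. (\<Sum>P\<in>\<Omega> i (length v). wt (take i u) v P) *
        var x * var (swap x) * frag_of (drop (Suc i) u))"
    by (simp add: frag_of_snoc diamond_mult_var sweedler_sum_frag_of snoc)
  also have "\<dots> = (\<Sum>P\<in>\<Omega> (length u) (Suc (length v)). wt u (v @ [x]) P)"
    by (simp add: sum_\<Omega>_Suc sum_distrib_right wt_snoc_U wt_append_D_replicate_R)
  finally show ?case by simp
qed

theorem theorem4p2:
  fixes u v :: "letter list" and p q :: nat
  assumes "length u = p" and "length v = q"
  shows "frag_of u \<diamondop> frag_of v = (\<Sum>P\<in>\<Omega> p q. wt u v P)"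
  using diamond_eq_sum_wt assms by blast

end
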